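(* Let $\mathbb{F}_{q^l}$ be a subfield of $\mathbb{F}_{q^m}$. Let $f_1,\dots,f_s\in\mathbb{F}_{q^l}\langle X^q\rangle$ have $q$-degrees $d_1,\dots,d_s$, let $n=\sum_i d_i$, and assume that each $f_i$ is coprime with the least left common multiple $b_i$ of the $f_j$, $j\ne i$. Let $e\in\prod_{i=1}^s\mathbb{F}_{q^m}\langle X^q\rangle_{d_i}$ have rank weight $w_r(e)\le r$, and let $E=\Phi(e)$ be its Chinese Remainder lifting. Then $$\operatorname{supp}(E)\subset\operatorname{supp}(e)\cdot\mathbb{F}_{q^l},$$ and hence $\dim_{\mathbb{F}_q}(\operatorname{supp}(E))\le r\cdot l$.
   Context: Let $q$ be a prime power and $m\ge1$. $\mathbb{F}_{q^m}\langle X^q\rangle$ is the set of linearized polynomials $\sum_{i=0}^d p_iX^{q^i}$, $p_i\in\mathbb{F}_{q^m}$, a non-commutative ring under addition and composition $\circ$, determined by $(aX^{q^i})\circ(bX^{q^j})=ab^{q^i}X^{q^{i+j}}$, with unit $X$; $\mathbb{F}_{q^l}\langle X^q\rangle$ is the subset with coefficients in $\mathbb{F}_{q^l}$. The $q$-degree of a nonzero element is the largest $i$ such that the coefficient of $X^{q^i}$ is nonzero; $\mathbb{F}_{q^m}\langle X^q\rangle_t$ is the set of elements of $q$-degree $<t$ (including $0$). Coprime means that the greatest right common divisor is $X$ (up to scalar); the least left common multiple is a generator of the intersection of the left ideals generated. $\Phi:\prod_{i=1}^s\mathbb{F}_{q^m}\langle X^q\rangle_{d_i}\to\mathbb{F}_{q^m}\langle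 X^q\rangle_n$ is the Chinese Remainder lifting: $\Phi(p_1,\dots,p_s)$ is the remainder of the right division of $\sum_{i}p_i\circ S_{1,i}\circ b_i$ by the least left common multiple of $f_1,\dots,f_s$, where $S_{1,i}\circ b_i+S_{2,i}\circ f_i=X$. Equivalently, $\Phi(\pi_1(p),\dots,\pi_s(p))=p$ for all $p$ of $q$-degree $<n$, $\pi_i(p)$ being the remainder of the right division of $p$ by $f_i$. The support $\operatorname{supp}$ of a linearized polynomial (resp. of a tuple of them) is the $\mathbb{F}_q$-subspace of $\mathbb{F}_{q^m}$ spanned by all its coefficients, and $w_r$ is the $\mathbb{F}_q$-dimension of the support. For $\mathbb{F}_q$-subspaces $\mathcal{A},\mathcal{B}$ of $\mathbb{F}_{q^m}$, $\mathcal{A}\cdot\mathcal{B}$ is the $\mathbb{F}_q$-span of $\{ab : a\in\mathcal{A},b\in\mathcal{B}\}$. *)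

theory Defs
  imports
    "HOL-Computational_Algebra.Polynomial"
    "HOL-Library.Cardinality"
    "HOL-Number_Theory.Prime_Powers"
begin

section \<open>Subfields and linear algebra over a subfield\<close>

definition is_subfield :: "'a::field set \<Rightarrow> bool" where
  "is_subfield K \<longleftrightarrow> 0 \<in> K \<and> 1 \<in> K \<and>
     (\<forall>x\<in>K. \<forall>y\<in>K. x + y \<in> K \<and> x * y \<in> K) \<and>
     (\<forall>x\<in>K. - x \<in> K \<and> inverse x \<in> K)"

definition subspace_over :: "'a::field set \<Rightarrow> 'a set \<Rightarrow> bool" where
  "subspace_over F V \<longleftrightarrow> 0 \<in> V \<and> (\<forall>x\<in>V. \<forall>y\<in>V. x + y \<in> V) \<and> (\<forall>c\<in>F. \<forall>x\<in>V. c * x \<in> V)"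

definition span_over :: "'a::field set \<Rightarrow> 'a set \<Rightarrow> 'a set" where
  "span_over F S = subspace_over F hull S"

definition independent_over :: "'a::field set \<Rightarrow> 'a set \<Rightarrow> bool" where
  "independent_over F B \<longleftrightarrow>
     (\<forall>u. (\<forall>x\<in>B. u x \<in> F) \<and> (\<Sum>x\<in>B. u x * x) = 0 \<longrightarrow> (\<forall>x\<in>B. u x = 0))"

text \<open>Only finite bases are considered: all spaces below lie in a finite field.\<close>

definition dim_over :: "'a::field set \<Rightarrow> 'a set \<Rightarrow> nat" where
  "dim_over F V = card (SOME B. finite B \<and> independent_over F B \<and> span_over F B = V)"

definition span_prod :: "'a::field set \<Rightarrow> 'a set \<Rightarrow> 'a set \<Rightarrow> 'a set" where
  "span_prod F A B = span_over F {a * b |a b. a \<in> A \<and> b \<in> B}"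


section \<open>Linearized polynomials\<close>

text \<open>
  Linearized polynomials are ordinary univariate polynomials whose only monomials are the
  \<open>X ^ (q ^ i)\<close>; the (non-commutative) product is \<^const>\<open>pcompose\<close> and the unit is
  \<open>X = [:0, 1:]\<close>.
\<close>

definition lin_polys_over :: "nat \<Rightarrow> 'a::field set \<Rightarrow> 'a poly set" where
  "lin_polys_over q K =
     {p. (\<forall>k. coeff p k \<noteq> 0 \<longrightarrow> (\<exists>i. k = q ^ i)) \<and> set (coeffs p) \<subseteq> K}"

abbreviation lin_polys :: "nat \<Rightarrow> 'a::field poly set" where
  "lin_polys q \<equiv> lin_polys_over q UNIV"

text \<open>Meaningful for nonzero linearized polynomials only.\<close>

definition q_degree :: "nat \<Rightarrow> 'a::field poly \<Rightarrow> nat" where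
  "q_degree q p = (GREATEST i. coeff p (q ^ i) \<noteq> 0)"

definition lin_polys_lt :: "nat \<Rightarrow> nat \<Rightarrow> 'a::field poly set" where
  "lin_polys_lt q t = {p \<in> lin_polys q. p = 0 \<or> q_degree q p < t}"

definition left_ideal :: "nat \<Rightarrow> 'a::field poly \<Rightarrow> 'a poly set" where
  "left_ideal q f = {pcompose g f |g. g \<in> lin_polys q}"

text \<open>\<open>p \<in> left_ideal q g\<close> says that \<open>g\<close> divides \<open>p\<close> on the right.\<close>

definition is_gcrd :: "nat \<Rightarrow> 'a::field poly \<Rightarrow> 'a poly \<Rightarrow> 'a poly \<Rightarrow> bool" where
  "is_gcrd q g f h \<longleftrightarrow> g \<in> lin_polys q \<and> f \<in> left_ideal q g \<and> h \<in> left_ideal q g \<and>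
     (\<forall>g'\<in>lin_polys q. f \<in> left_ideal q g' \<and> h \<in> left_ideal q g' \<longrightarrow> g \<in> left_ideal q g')"

definition right_coprime :: "nat \<Rightarrow> 'a::field poly \<Rightarrow> 'a poly \<Rightarrow> bool" where
  "right_coprime q f h \<longleftrightarrow> (\<exists>c. c \<noteq> 0 \<and> is_gcrd q (smult c [:0, 1:]) f h)"

text \<open>The intersection of an empty family of left ideals is the whole ring.\<close>

definition is_lclm :: "nat \<Rightarrow> 'a::field poly set \<Rightarrow> 'a poly \<Rightarrow> bool" where
  "is_lclm q A g \<longleftrightarrow> g \<in> lin_polys q \<and> left_ideal q g = lin_polys q \<inter> (\<Inter>f\<in>A. left_ideal q f)"

text \<open>
  A generator is unique only up to a nonzero scalar; neither \<^term>\<open>right_coprime q f\<close> nor the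
  lifting below depends on which one is chosen.
\<close>

definition lclm :: "nat \<Rightarrow> 'a::field poly set \<Rightarrow> 'a poly" where
  "lclm q A = (SOME g. is_lclm q A g)"

definition right_rem :: "nat \<Rightarrow> 'a::field poly \<Rightarrow> 'a poly \<Rightarrow> 'a poly" where
  "right_rem q p f =
     (THE r. r \<in> lin_polys_lt q (q_degree q f) \<and> (\<exists>g\<in>lin_polys q. p = pcompose g f + r))"


section \<open>Chinese Remainder lifting\<close>

definition cofactor_lclm :: "nat \<Rightarrow> nat \<Rightarrow> (nat \<Rightarrow> 'a::field poly) \<Rightarrow> nat \<Rightarrow> 'a poly" where
  "cofactor_lclm q s f i = lclm q (f ` ({1..s} - {i}))"

definition bezout_left :: "nat \<Rightarrow> 'a::field poly \<Rightarrow> 'a poly \<Rightarrow> 'a poly" where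
  "bezout_left q b f =
     (SOME S1. S1 \<in> lin_polys q \<and>
        (\<exists>S2\<in>lin_polys q. pcompose S1 b + pcompose S2 f = [:0, 1:]))"

text \<open>
  Different Bezout coefficients give the same lifting: \<open>S\<^sub>1 \<circ> b\<^sub>i\<close> is always congruent to \<open>X\<close>
  modulo \<open>f\<^sub>i\<close> and to \<open>0\<close> modulo the other \<open>f\<^sub>j\<close>.
\<close>

definition crt_lift ::
  "nat \<Rightarrow> nat \<Rightarrow> (nat \<Rightarrow> 'a::field poly) \<Rightarrow> (nat \<Rightarrow> 'a poly) \<Rightarrow> 'a poly" where
  "crt_lift q s f p =
     right_rem q
       (\<Sum>i=1..s. pcompose (p i)
          (pcompose (bezout_left q (cofactor_lclm q s f i) (f i)) (cofactor_lclm q s f i)))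
       (lclm q (f ` {1..s}))"


section \<open>Support and rank weight\<close>

definition supp :: "'a::field set \<Rightarrow> 'a poly \<Rightarrow> 'a set" where
  "supp F p = span_over F (set (coeffs p))"

definition supp_tuple :: "'a::field set \<Rightarrow> nat \<Rightarrow> (nat \<Rightarrow> 'a poly) \<Rightarrow> 'a set" where
  "supp_tuple F s p = span_over F (\<Union>i\<in>{1..s}. set (coeffs (p i)))"

definition rank_weight :: "'a::field set \<Rightarrow> nat \<Rightarrow> (nat \<Rightarrow> 'a poly) \<Rightarrow> nat" where
  "rank_weight F s p = dim_over F (supp_tuple F s p)"

end

theory Submission
  imports Defs
begin

text \<open>
  Let \<open>V = supp(e) \<cdot> K\<close>, a subspace over \<open>K\<close>. The map \<open>\<phi>(x) = \<Prod>v\<in>V. (x - v)\<close> is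
  \<open>K\<close>-linear with kernel \<open>V\<close>. Since \<open>f\<^sub>j\<close> has coefficients in \<open>K\<close>, applying \<open>\<phi>\<close> to all
  coefficients of \<open>E = g \<circ> f\<^sub>j + e\<^sub>j\<close> gives \<open>\<phi>(E) = \<phi>(g) \<circ> f\<^sub>j\<close>. Hence \<open>\<phi>(E)\<close> is a common left
  multiple of the \<open>f\<^sub>j\<close> of degree smaller than their least one, so \<open>\<phi>(E) = 0\<close>, which means
  that the coefficients of \<open>E\<close> lie in \<open>V\<close>. The dimension bound follows by counting elements.
\<close>

section \<open>Linear algebra over a finite subfield\<close>

lemma subspace_over_span: "subspace_over F (span_over F S)"
  unfolding span_over_def by (rule hull_in) (auto simp: subspace_over_def)

lemma span_over_superset: "S \<subseteq> span_over F S"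
  unfolding span_over_def by (rule hull_subset)

lemma span_over_minimal: "S \<subseteq> V \<Longrightarrow> subspace_over F V \<Longrightarrow> span_over F S \<subseteq> V"
  unfolding span_over_def by (rule hull_minimal)

lemma subspace_over_sum:
  assumes "subspace_over F V" "\<And>x. x \<in> A \<Longrightarrow> f x \<in> V"
  shows "sum f A \<in> V"
  using assms(2)
proof (induction A rule: infinite_finite_induct)
  case (insert x A)
  then show ?case using assms(1) by (auto simp: subspace_over_def)
qed (use assms(1) in \<open>auto simp: subspace_over_def\<close>)

text \<open>The linear combinations of \<open>B\<close> contain \<open>B\<close>, form a subspace,
  and lie in every subspace containing \<open>B\<close>. Taking coefficient functions extensional on
  \<open>B\<close> makes them a finite set that can be counted.\<close>

lemma span_over_finite:
  assumes F: "is_subfield F" and B: "finite B"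
  shows "span_over F B = (\<lambda>u. \<Sum>x\<in>B. u x * x) ` (B \<rightarrow>\<^sub>E F)" (is "_ = ?R")
  unfolding span_over_def
proof (rule hull_unique)
  show "B \<subseteq> ?R"
  proof
    fix x assume x: "x \<in> B"
    have "x = (\<Sum>y\<in>B. (\<lambda>y\<in>B. if y = x then 1 else 0) y * y)"
      using x B by (simp add: if_distrib[of "\<lambda>c. c * _"] cong: if_cong)
    moreover have "(\<lambda>y\<in>B. if y = x then 1 else 0) \<in> B \<rightarrow>\<^sub>E F"
      using F by (auto simp: is_subfield_def)
    ultimately show "x \<in> ?R" by blast
  qed
  show "subspace_over F ?R"
    unfolding subspace_over_def
  proof (intro conjI ballI)
    have "0 = (\<Sum>y\<in>B. (\<lambda>y\<in>B. 0) y * y)" by simp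
    moreover have "(\<lambda>y\<in>B. 0) \<in> B \<rightarrow>\<^sub>E F"
      using F by (auto simp: is_subfield_def)
    ultimately show "0 \<in> ?R" by blast
  next
    fix x y assume "x \<in> ?R" "y \<in> ?R"
    then obtain u v where u: "u \<in> B \<rightarrow>\<^sub>E F" "x = (\<Sum>x\<in>B. u x * x)"
      and v: "v \<in> B \<rightarrow>\<^sub>E F" "y = (\<Sum>x\<in>B. v x * x)" by auto
    have "x + y = (\<Sum>x\<in>B. (\<lambda>x\<in>B. u x + v x) x * x)"
      by (simp add: u(2) v(2) sum.distrib algebra_simps)
    moreover have "(\<lambda>x\<in>B. u x + v x) \<in> B \<rightarrow>\<^sub>E F"
      using F u(1) v(1) by (auto simp: is_subfield_def PiE_iff)
    ultimately show "x + y \<in> ?R" by blast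
  next
    fix c x assume "c \<in> F" "x \<in> ?R"
    then obtain u where u: "u \<in> B \<rightarrow>\<^sub>E F" "x = (\<Sum>x\<in>B. u x * x)" by auto
    have "c * x = (\<Sum>x\<in>B. (\<lambda>x\<in>B. c * u x) x * x)"
      by (simp add: u(2) sum_distrib_left algebra_simps)
    moreover have "(\<lambda>x\<in>B. c * u x) \<in> B \<rightarrow>\<^sub>E F"
      using F u(1) \<open>c \<in> F\<close> by (auto simp: is_subfield_def PiE_iff)
    ultimately show "c * x \<in> ?R" by blast
  qed
next
  fix V assume "B \<subseteq> V" "subspace_over F V"
  then show "?R \<subseteq> V"
    by (auto intro!: subspace_over_sum) (auto simp: subspace_over_def PiE_iff)
qed

lemma card_span_independent:
  assumes F: "is_subfield F" and B: "finite B" "independent_over F B"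
  shows "card (span_over F B) = card F ^ card B"
proof -
  have "inj_on (\<lambda>u. \<Sum>x\<in>B. u x * x) (B \<rightarrow>\<^sub>E F)"
  proof (rule inj_onI)
    fix u v assume u: "u \<in> B \<rightarrow>\<^sub>E F" and v: "v \<in> B \<rightarrow>\<^sub>E F"
      and eq: "(\<Sum>x\<in>B. u x * x) = (\<Sum>x\<in>B. v x * x)"
    \<comment> \<open>The difference is written as a sum because \<open>is_subfield\<close> gives
      closure under addition and negation.\<close>
    have "\<forall>x\<in>B. u x + - v x \<in> F"
      using F PiE_mem[OF u] PiE_mem[OF v] unfolding is_subfield_def by blast
    moreover have "(\<Sum>x\<in>B. (u x + - v x) * x) = 0"
      using eq by (simp add: algebra_simps sum_subtractf)
    ultimately have "\<forall>x\<in>B. u x + - v x = 0"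
      using B(2) unfolding independent_over_def by fast
    then show "u = v" using u v by (auto intro!: PiE_ext[OF u v])
  qed
  then show ?thesis
    by (simp add: span_over_finite[OF F B(1)] card_image card_funcsetE[OF B(1)])
qed

text \<open>A spanning set of least cardinality is independent, since a nontrivial relation would
  allow one of its elements to be dropped.\<close>

lemma exists_basis_over:
  assumes F: "is_subfield F" and V: "subspace_over F V" "finite V"
  shows "\<exists>B. finite B \<and> independent_over F B \<and> span_over F B = V"
proof -
  let ?P = "\<lambda>B. finite B \<and> span_over F B = V"
  have "?P V"
    using V span_over_superset[of V F] span_over_minimal[of V V F] by blast
  then obtain B where B: "?P B" and min: "\<And>C. ?P C \<Longrightarrow> card B \<le> card C"
    using ex_has_least_nat[of ?P V card] by blast
  have "independent_over F B"
    unfolding independent_over_def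
  proof (intro allI impI ballI, rule ccontr)
    fix u x assume u: "(\<forall>x\<in>B. u x \<in> F) \<and> (\<Sum>x\<in>B. u x * x) = 0"
      and x: "x \<in> B" "u x \<noteq> 0"
    let ?C = "B - {x}"
    have "u x * x = - (\<Sum>y\<in>?C. u y * y)"
      using u x B by (simp add: sum.remove eq_neg_iff_add_eq_0)
    \<comment> \<open>The relation is solved for \<open>x\<close>, so the remaining vectors already
      span \<open>V\<close>, against minimality.\<close>
    then have x_eq: "x = (- inverse (u x)) * (\<Sum>y\<in>?C. u y * y)"
      using x(2) by (simp add: field_simps)
    have "(\<Sum>y\<in>?C. u y * y) \<in> span_over F ?C"
      using subspace_over_span[of F ?C] span_over_superset[of ?C F] u
      by (intro subspace_over_sum[of F]) (auto simp: subspace_over_def)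
    moreover have "- inverse (u x) \<in> F"
      using F u x by (auto simp: is_subfield_def)
    ultimately have "(- inverse (u x)) * (\<Sum>y\<in>?C. u y * y) \<in> span_over F ?C"
      using subspace_over_span[of F ?C] unfolding subspace_over_def by blast
    with x_eq have "x \<in> span_over F ?C" by simp
    then have "B \<subseteq> span_over F ?C"
      using span_over_superset[of ?C F] by blast
    then have "V \<subseteq> span_over F ?C"
      using B span_over_minimal[OF _ subspace_over_span] by blast
    moreover have "span_over F ?C \<subseteq> V"
      using B span_over_minimal[of ?C V F] V span_over_superset[of B F] by blast
    ultimately have "card B \<le> card ?C" using B by (intro min) auto
    then show False using B x by (metis card_Diff1_less linorder_not_less)
  qed
  with B show ?thesis by blast
qed

lemma basis_over:
  assumes "is_subfield F" "subspace_over F V" "finite V"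
  obtains B where "finite B" "independent_over F B" "span_over F B = V" "card B = dim_over F V"
  using someI_ex[OF exists_basis_over[OF assms]] unfolding dim_over_def by blast

text \<open>Recovers the dimension from the number of elements, so bases never have to be compared
  with one another.\<close>

lemma card_subspace_over:
  assumes "is_subfield F" "subspace_over F V" "finite V"
  shows "card V = card F ^ dim_over F V"
  using basis_over[OF assms] card_span_independent[OF assms(1)] by metis

text \<open>\<open>span_prod\<close> is only an \<open>F\<close>-span by definition. Its generating
  set is stable under multiplication by \<open>K\<close>, and this passes to the span.\<close>

lemma subspace_over_span_prod:
  assumes K: "is_subfield K"
  shows "subspace_over K (span_prod F A K)"
proof -
  let ?W = "span_prod F A K"
  have sub: "subspace_over F ?W"
    unfolding span_prod_def by (rule subspace_over_span)
  have "c * x \<in> ?W" if "c \<in> K" "x \<in> ?W" for c x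
  proof -
    \<comment> \<open>The vectors that \<open>c\<close> multiplies into the span form an
      \<open>F\<close>-subspace containing the generators.\<close>
    have "?W \<subseteq> {x. c * x \<in> ?W}"
      unfolding span_prod_def
    proof (rule span_over_minimal)
      show "{a * b |a b. a \<in> A \<and> b \<in> K}
          \<subseteq> {x. c * x \<in> span_over F {a * b |a b. a \<in> A \<and> b \<in> K}}"
      proof clarify
        fix a b assume "a \<in> A" "b \<in> K"
        then have "a * (c * b) \<in> {a * b |a b. a \<in> A \<and> b \<in> K}"
          using K \<open>c \<in> K\<close> by (auto simp: is_subfield_def)
        then show "c * (a * b) \<in> span_over F {a * b |a b. a \<in> A \<and> b \<in> K}"
          using span_over_superset by (force simp: mult.left_commute)
      qed
      show "subspace_over F {x. c * x \<in> span_over F {a * b |a b. a \<in> A \<and> b \<in> K}}"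
        using subspace_over_span[of F "{a * b |a b. a \<in> A \<and> b \<in> K}"]
        by (auto simp: subspace_over_def distrib_left mult.left_commute[of c])
    qed
    then show ?thesis using that(2) by blast
  qed
  then show ?thesis using sub by (auto simp: subspace_over_def)
qed

text \<open>An \<open>F\<close>-basis of \<open>A\<close> generates the product space over
  \<open>K\<close>, so there are at most as many elements as coefficient vectors over
  \<open>K\<close>.\<close>

lemma card_span_prod_le:
  assumes F: "is_subfield F" and K: "is_subfield K" "finite K" and "F \<subseteq> K"
    and A: "subspace_over F A" "finite A"
  shows "card (span_prod F A K) \<le> card K ^ dim_over F A"
proof -
  obtain B where B: "finite B" "span_over F B = A" "card B = dim_over F A"
    using basis_over[OF F A] by metis
  let ?W = "(\<lambda>u. \<Sum>x\<in>B. u x * x) ` (B \<rightarrow>\<^sub>E K)"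
  have W: "?W = span_over K B" using span_over_finite[OF K(1) B(1)] by simp
  have subK: "subspace_over K (span_over K B)" by (rule subspace_over_span)
  then have subF: "subspace_over F (span_over K B)"
    using \<open>F \<subseteq> K\<close> by (auto simp: subspace_over_def)
  have "A \<subseteq> span_over K B"
    unfolding B(2)[symmetric] by (rule span_over_minimal[OF span_over_superset subF])
  then have "a * b \<in> span_over K B" if "a \<in> A" "b \<in> K" for a b
    using subK that unfolding subspace_over_def by (subst mult.commute) blast
  then have "span_prod F A K \<subseteq> span_over K B"
    unfolding span_prod_def by (intro span_over_minimal[OF _ subF]) blast
  then have "card (span_prod F A K) \<le> card ?W"
    unfolding W[symmetric] using B(1) K(2) by (intro card_mono finite_imageI finite_PiE) auto
  also have "\<dots> \<le> card (B \<rightarrow>\<^sub>E K)"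
    using B(1) K(2) by (intro card_image_le finite_PiE) auto
  finally show ?thesis using B by (simp add: card_funcsetE)
qed

section \<open>Finite subfields\<close>

text \<open>Fermat's argument: multiplication by a nonzero \<open>x\<close> permutes the nonzero
  elements of \<open>K\<close>, and their product cancels.\<close>

lemma subfield_power_card:
  assumes K: "is_subfield K" "finite K" and x: "x \<in> K"
  shows "x ^ card K = x"
proof (cases "x = 0")
  case True
  have "card K > 0" using K x by (auto simp: card_gt_0_iff)
  then show ?thesis using True by simp
next
  case False
  let ?K = "K - {0}"
  have "(*) x ` ?K = ?K"
  proof (rule card_subset_eq)
    show "(*) x ` ?K \<subseteq> ?K" using K x False by (auto simp: is_subfield_def)
    show "card ((*) x ` ?K) = card ?K" using False by (intro card_image) (auto simp: inj_on_def)
  qed (use K in auto)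
  then have "bij_betw ((*) x) ?K ?K"
    using False by (auto simp: bij_betw_def inj_on_def)
  then have "(\<Prod>y\<in>?K. x * y) = \<Prod>?K"
    by (rule prod.reindex_bij_betw)
  then have "x ^ card ?K * \<Prod>?K = \<Prod>?K"
    by (simp add: prod.distrib)
  moreover have "\<Prod>?K \<noteq> 0" using K by (subst prod_zero_iff) auto
  ultimately have "x ^ card ?K = 1" by simp
  moreover have "card K = Suc (card ?K)"
    using K by (subst card.remove[of K 0]) (auto simp: is_subfield_def)
  ultimately show ?thesis by simp
qed

lemma power_power_eq_self: "x ^ a = x \<Longrightarrow> x ^ (a ^ k) = x" for x :: "'a::monoid_mult"
proof (induction k)
  case (Suc k)
  have "x ^ (a ^ Suc k) = (x ^ a) ^ (a ^ k)" by (simp flip: power_mult)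
  then show ?case using Suc by simp
qed simp

text \<open>The polynomial \<open>X ^ card K - X\<close> has at most \<open>card K\<close> roots,
  and \<open>K\<close> already supplies that many.\<close>

lemma subfield_eq_fixed_points:
  fixes K :: "'a::field set"
  assumes K: "is_subfield K" "finite K"
  shows "K = {x. x ^ card K = x}"
proof -
  let ?p = "monom 1 (card K) - [:0, 1:] :: 'a poly"
  have "{0, 1} \<subseteq> K" using K by (auto simp: is_subfield_def)
  then have gt: "card K > 1" using card_mono[of K "{0, 1}"] K(2) by simp
  have deg: "degree ?p = card K"
    unfolding diff_conv_add_uminus using gt
    by (subst degree_add_eq_left) (auto simp: degree_monom_eq)
  then have "?p \<noteq> 0" using gt by auto
  have roots: "{x. x ^ card K = x} = {x. poly ?p x = 0}"
    by (auto simp: poly_monom)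
  have "K \<subseteq> {x. poly ?p x = 0}"
    using subfield_power_card[OF K] roots by blast
  moreover have "card {x. poly ?p x = 0} \<le> card K"
    using card_poly_roots_bound[OF \<open>?p \<noteq> 0\<close>] deg by simp
  ultimately show ?thesis
    unfolding roots using poly_roots_finite[OF \<open>?p \<noteq> 0\<close>] card_seteq by blast
qed

text \<open>A finite field has at most one subfield of each size, so cardinalities alone decide this
  inclusion: elements of \<open>F\<close> are fixed by the power \<open>card F\<close>, hence by its
  iterates.\<close>

lemma subfield_mono:
  assumes "is_subfield F" "finite F" "is_subfield K" "finite K" "card K = card F ^ l"
  shows "F \<subseteq> K"
  using subfield_eq_fixed_points[OF assms(3,4)] subfield_power_card[OF assms(1,2)] assms(5)
  by (auto simp: power_power_eq_self)

section \<open>The annihilator polynomial of a subspace\<close>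

text \<open>For fixed \<open>y\<close>, both sides are monic polynomials in \<open>x\<close> of
  degree \<open>card V\<close>. They agree at the \<open>card V\<close> points of \<open>V\<close>,
  because translation by an element of \<open>V\<close> permutes \<open>V\<close>; hence they are
  equal.\<close>

lemma annihilator_additive:
  fixes V :: "'a::field set"
  assumes V: "finite V" "subspace_over K V"
  shows "(\<Prod>v\<in>V. x + y - v) = (\<Prod>v\<in>V. x - v) + (\<Prod>v\<in>V. y - v)"
proof -
  let ?G = "\<Prod>v\<in>V. [:- v, 1:]"
  have G: "poly ?G z = (\<Prod>v\<in>V. z - v)" for z by (simp add: poly_prod)
  have monic: "lead_coeff ?G = 1" by (simp add: lead_coeff_prod)
  have deg: "degree ?G = card V" by (subst degree_prod_eq_sum_degree) auto
  have pos: "card V > 0" using V by (auto simp: card_gt_0_iff subspace_over_def)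
  have shift: "(\<Prod>v\<in>V. z + y - v) = (\<Prod>v\<in>V. y - v)" if "z \<in> V" for z
  proof (rule prod.reindex_bij_witness[of _ "\<lambda>v. v + z" "\<lambda>v. v - z"])
    fix v assume "v \<in> V"
    then show "v + z \<in> V" using V that by (auto simp: subspace_over_def)
    show "v - z \<in> V"
    proof -
      \<comment> \<open>\<open>K\<close> is an arbitrary set here, so closure of \<open>V\<close>
        under subtraction comes from finiteness: an injective translation of \<open>V\<close> into
        itself is onto.\<close>
      have inj: "inj_on (\<lambda>w. w + z) V" by (auto simp: inj_on_def)
      have "(\<lambda>w. w + z) ` V = V"
        using V that by (intro card_subset_eq card_image inj) (auto simp: subspace_over_def)
      then have "v \<in> (\<lambda>w. w + z) ` V" using \<open>v \<in> V\<close> by simp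
      then show ?thesis by auto
    qed
  qed (auto simp: algebra_simps)
  have "pcompose ?G [:y, 1:] = ?G + [:poly ?G y:]"
  proof (rule poly_eqI_degree_lead_coeff[where n = "card V" and A = V])
    have "coeff (pcompose ?G [:y, 1:]) (card V) = lead_coeff (pcompose ?G [:y, 1:])"
      by (simp add: degree_pcompose deg)
    also have "\<dots> = 1" using monic by (subst lead_coeff_comp) auto
    \<comment> \<open>Since \<open>card V > 0\<close>, the added constant leaves the leading
      coefficient unchanged.\<close>
    finally show "coeff (pcompose ?G [:y, 1:]) (card V) = coeff (?G + [:poly ?G y:]) (card V)"
      using monic pos by (auto simp: deg coeff_pCons split: nat.splits)
    show "degree (?G + [:poly ?G y:]) \<le> card V" by (intro degree_add_le) (auto simp: deg)
    fix z assume z: "z \<in> V"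
    have "(\<Prod>v\<in>V. z - v) = 0" using V z by (intro prod_zero) auto
    then show "poly (pcompose ?G [:y, 1:]) z = poly (?G + [:poly ?G y:]) z"
      using shift[OF z] by (simp add: poly_pcompose G add.commute)
  qed (auto simp: degree_pcompose deg)
  from arg_cong[OF this, of "\<lambda>p. poly p x"] show ?thesis
    by (simp add: poly_pcompose G add.commute)
qed

text \<open>Scaling by a nonzero \<open>c\<close> permutes \<open>V\<close> and extracts the factor
  \<open>c ^ card V\<close>. This is \<open>c\<close>, because \<open>card V\<close> is a power of
  \<open>card K\<close>.\<close>

lemma annihilator_scale:
  fixes V :: "'a::field set"
  assumes K: "is_subfield K" "finite K" and V: "finite V" "subspace_over K V" and c: "c \<in> K"
  shows "(\<Prod>v\<in>V. c * x - v) = c * (\<Prod>v\<in>V. x - v)"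
proof (cases "c = 0")
  case True
  have "0 \<in> V" using V by (auto simp: subspace_over_def)
  then show ?thesis using True V by (auto intro!: prod_zero)
next
  case False
  have "(\<Prod>v\<in>V. c * x - v) = (\<Prod>v\<in>V. c * (x - v))"
  proof (rule prod.reindex_bij_witness[of _ "\<lambda>v. c * v" "\<lambda>v. inverse c * v"])
    fix v assume "v \<in> V"
    then show "c * v \<in> V" "inverse c * v \<in> V"
      using V K c by (auto simp: subspace_over_def is_subfield_def)
  qed (use False in \<open>auto simp: field_simps\<close>)
  also have "\<dots> = c ^ card V * (\<Prod>v\<in>V. x - v)" by (simp add: prod.distrib)
  also have "c ^ card V = c"
    unfolding card_subspace_over[OF K(1) V(2,1)]
    by (intro power_power_eq_self subfield_power_card K c)
  finally show ?thesis .
qed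

lemma linear_map_with_kernel:
  fixes V :: "'a::field set"
  assumes "is_subfield K" "finite K" "finite V" "subspace_over K V"
  shows "\<exists>\<phi> :: 'a \<Rightarrow> 'a. (\<forall>x y. \<phi> (x + y) = \<phi> x + \<phi> y) \<and>
    (\<forall>c\<in>K. \<forall>x. \<phi> (c * x) = c * \<phi> x) \<and> (\<forall>x. \<phi> x = 0 \<longleftrightarrow> x \<in> V)"
proof (intro exI conjI allI ballI)
  let ?\<phi> = "\<lambda>x. \<Prod>v\<in>V. x - v"
  show "?\<phi> (x + y) = ?\<phi> x + ?\<phi> y" for x y
    by (rule annihilator_additive[OF assms(3,4)])
  show "?\<phi> (c * x) = c * ?\<phi> x" if "c \<in> K" for c x
    by (rule annihilator_scale[OF assms that])
  show "?\<phi> x = 0 \<longleftrightarrow> x \<in> V" for x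
    using assms(3) by (auto simp: prod_zero_iff)
qed

section \<open>Linearized polynomials\<close>

lemma prime_CHAR_finite_field: "prime CHAR('a::{field,finite})"
  by (intro prime_CHAR_semidom finite_imp_CHAR_pos) auto

text \<open>Translation by 1 permutes the field, so it preserves the sum of all elements while
  adding \<open>CARD('a)\<close> times 1 to it.\<close>

lemma CHAR_dvd_CARD_finite: "CHAR('a::{field,finite}) dvd CARD('a)"
proof -
  have "(\<Sum>x\<in>UNIV. x + 1) = (\<Sum>x\<in>UNIV. x :: 'a)"
    by (rule sum.reindex_bij_witness[of _ "\<lambda>x. x - 1" "\<lambda>x. x + 1"]) auto
  then have "of_nat CARD('a) = (0 :: 'a)" by (simp add: sum.distrib)
  then show ?thesis by (simp add: of_nat_eq_0_iff_char_dvd)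
qed

lemma pcompose_monom: "pcompose (monom c k) f = smult c (f ^ k)"
  by (induction k) (simp_all add: monom_0 monom_Suc pcompose_pCons)

lemma pcompose_eq_sum:
  assumes "degree p \<le> N"
  shows "pcompose p f = (\<Sum>k\<le>N. smult (coeff p k) (f ^ k))"
proof -
  have "pcompose p f = pcompose (\<Sum>k\<le>N. monom (coeff p k) k) f"
    using poly_as_sum_of_monoms'[OF assms] by simp
  then show ?thesis by (simp add: pcompose_sum pcompose_monom)
qed

lemma finite_degree_less: "finite {p :: 'a::{zero,finite} poly. degree p < n}"
proof (rule finite_subset)
  show "{p :: 'a poly. degree p < n} \<subseteq> Poly ` {xs. set xs \<subseteq> UNIV \<and> length xs \<le> n}"
  proof
    fix p :: "'a poly" assume "p \<in> {p. degree p < n}"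
    then have "length (coeffs p) \<le> n"
      by (cases "p = 0") (auto simp: length_coeffs_degree)
    then have "Poly (coeffs p) \<in> Poly ` {xs. set xs \<subseteq> UNIV \<and> length xs \<le> n}"
      by blast
    then show "p \<in> Poly ` {xs. set xs \<subseteq> UNIV \<and> length xs \<le> n}" by simp
  qed
qed (intro finite_imageI finite_lists_length_le, simp)

lemma lin_polys_iff: "p \<in> lin_polys q \<longleftrightarrow> (\<forall>k. coeff p k \<noteq> 0 \<longrightarrow> (\<exists>i. k = q ^ i))"
  by (simp add: lin_polys_over_def)

lemma lin_polys_0: "0 \<in> lin_polys q"
  by (simp add: lin_polys_iff)

lemma lin_polys_X: "[:0, 1:] \<in> lin_polys q"
  by (auto simp: lin_polys_iff coeff_pCons split: nat.splits intro: exI[of _ 0])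

lemma lin_polys_monom: "monom c (q ^ i) \<in> lin_polys q"
  by (auto simp: lin_polys_iff)

lemma lin_polys_add: "f \<in> lin_polys q \<Longrightarrow> g \<in> lin_polys q \<Longrightarrow> f + g \<in> lin_polys q"
  unfolding lin_polys_iff by (metis add.right_neutral coeff_add)

lemma lin_polys_smult: "f \<in> lin_polys q \<Longrightarrow> smult c f \<in> lin_polys q"
  by (simp add: lin_polys_iff)

lemma lin_polys_diff: "f \<in> lin_polys q \<Longrightarrow> g \<in> lin_polys q \<Longrightarrow> f - g \<in> lin_polys q"
  using lin_polys_add[of f q "smult (-1) g"] lin_polys_smult[of g q "-1"] by simp

lemma lin_polys_sum: "(\<And>i. i \<in> A \<Longrightarrow> f i \<in> lin_polys q) \<Longrightarrow> sum f A \<in> lin_polys q"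
  by (induction A rule: infinite_finite_induct) (auto intro: lin_polys_0 lin_polys_add)

section \<open>Frobenius powers and composition of linearized polynomials\<close>

text \<open>Powers of the characteristic make \<open>x \<mapsto> x ^ (q ^ i)\<close> additive, also
  on polynomials; the positive exponent ensures \<open>q > 1\<close>.\<close>

locale frobenius_power =
  fixes q :: nat and ty :: "'a::{field,finite} itself"
  assumes q_CHAR: "\<exists>k>0. q = CHAR('a) ^ k"
begin

lemma q_gt_1: "q > 1"
  using q_CHAR prime_gt_1_nat[OF prime_CHAR_finite_field[where 'a = 'a]] one_less_power by blast

lemma q_power_CHAR: "\<exists>n. q ^ i = CHAR('a poly) ^ n"
  using q_CHAR by (auto simp flip: power_mult)

lemma power_q_add: "(x + y :: 'a poly) ^ (q ^ i) = x ^ (q ^ i) + y ^ (q ^ i)"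
  using q_power_CHAR[of i] prime_CHAR_finite_field[where 'a = 'a]
    freshmans_dream'[where 'a = "'a poly"] by auto

lemma power_q_sum: "(sum f A :: 'a poly) ^ (q ^ i) = (\<Sum>x\<in>A. f x ^ (q ^ i))"
  using q_power_CHAR[of i] prime_CHAR_finite_field[where 'a = 'a]
    freshmans_dream_sum'[where 'a = "'a poly"] by auto

text \<open>Additivity in the inner argument is special to linearized polynomials: each monomial
  acts as a scaled Frobenius power.\<close>

lemma pcompose_lin_add:
  assumes "(p :: 'a poly) \<in> lin_polys q"
  shows "pcompose p (f + g) = pcompose p f + pcompose p g"
proof -
  have "smult (coeff p k) ((f + g) ^ k) = smult (coeff p k) (f ^ k) + smult (coeff p k) (g ^ k)" for k
  proof (cases "coeff p k = 0")
    case False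
    then obtain i where "k = q ^ i" using assms by (auto simp: lin_polys_iff)
    then show ?thesis by (simp add: power_q_add smult_add_right)
  qed simp
  then show ?thesis by (simp add: pcompose_eq_sum[OF order_refl] sum.distrib)
qed

lemma pcompose_lin_diff:
  assumes "(p :: 'a poly) \<in> lin_polys q"
  shows "pcompose p (f - g) = pcompose p f - pcompose p g"
  using pcompose_lin_add[OF assms, of "f - g" g] by simp

lemma lin_polys_power:
  assumes "(f :: 'a poly) \<in> lin_polys q"
  shows "f ^ (q ^ i) \<in> lin_polys q"
proof -
  have "f ^ (q ^ i) = (\<Sum>k\<le>degree f. monom (coeff f k) k) ^ (q ^ i)"
    by (simp add: poly_as_sum_of_monoms)
  also have "\<dots> = (\<Sum>k\<le>degree f. monom (coeff f k ^ (q ^ i)) (k * q ^ i))"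
    by (simp add: power_q_sum monom_power)
  also have "\<dots> \<in> lin_polys q"
  proof (rule lin_polys_sum)
    fix k
    show "monom (coeff f k ^ (q ^ i)) (k * q ^ i) \<in> lin_polys q"
    proof (cases "coeff f k = 0")
      case True
      \<comment> \<open>Here \<open>k\<close> may fail to be a power of \<open>q\<close>, but the
        coefficient \<open>0 ^ (q ^ i)\<close> vanishes because \<open>q ^ i > 0\<close>.\<close>
      then show ?thesis using q_gt_1 by (simp add: power_0_left lin_polys_0)
    next
      case False
      then obtain j where "k = q ^ j" using assms by (auto simp: lin_polys_iff)
      then have "k * q ^ i = q ^ (j + i)" by (simp add: power_add)
      then show ?thesis by (simp only: lin_polys_monom)
    qed
  qed
  finally show ?thesis .
qed

lemma lin_polys_pcompose:
  assumes "(p :: 'a poly) \<in> lin_polys q" "f \<in> lin_polys q"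
  shows "pcompose p f \<in> lin_polys q"
  unfolding pcompose_eq_sum[OF order_refl]
proof (rule lin_polys_sum)
  fix k
  show "smult (coeff p k) (f ^ k) \<in> lin_polys q"
  proof (cases "coeff p k = 0")
    case False
    then obtain j where "k = q ^ j" using assms by (auto simp: lin_polys_iff)
    then show ?thesis using assms by (simp add: lin_polys_smult lin_polys_power)
  qed (simp add: lin_polys_0)
qed

section \<open>Degrees and right division\<close>

text \<open>Translates \<open>q\<close>-degrees into ordinary degrees, on which the division
  arguments run.\<close>

lemma degree_lin_poly:
  assumes "(p :: 'a poly) \<in> lin_polys q" "p \<noteq> 0"
  shows "degree p = q ^ q_degree q p"
proof -
  obtain i where i: "degree p = q ^ i"
    using assms leading_coeff_neq_0 unfolding lin_polys_iff by blast
  have "q_degree q p = i"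
    unfolding q_degree_def
  proof (rule Greatest_equality)
    show "coeff p (q ^ i) \<noteq> 0" using assms(2) by (simp flip: i)
    show "j \<le> i" if "coeff p (q ^ j) \<noteq> 0" for j
      using le_degree[OF that] q_gt_1 by (simp add: i)
  qed
  then show ?thesis using i by simp
qed

lemma degree_lin_poly_pos: "(p :: 'a poly) \<in> lin_polys q \<Longrightarrow> p \<noteq> 0 \<Longrightarrow> degree p > 0"
  using degree_lin_poly q_gt_1 by simp

lemma lin_polys_lt_q_degree_iff:
  assumes "(f :: 'a poly) \<in> lin_polys q" "f \<noteq> 0"
  shows "(r :: 'a poly) \<in> lin_polys_lt q (q_degree q f) \<longleftrightarrow> r \<in> lin_polys q \<and> degree r < degree f"
proof (cases "r = 0")
  case True
  then show ?thesis
    using degree_lin_poly_pos[OF assms] by (simp add: lin_polys_lt_def lin_polys_0)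
next
  case False
  then have "degree r < degree f \<longleftrightarrow> q_degree q r < q_degree q f" if "r \<in> lin_polys q"
    using q_gt_1 assms degree_lin_poly[OF that False] by (simp add: degree_lin_poly)
  then show ?thesis using False by (auto simp: lin_polys_lt_def)
qed

text \<open>Euclidean division: a left multiple of \<open>f\<close> by a suitable monomial cancels
  the leading term of \<open>p\<close>, and induction on the degree finishes.\<close>

lemma right_division:
  fixes p f :: "'a poly"
  assumes f: "f \<in> lin_polys q" "f \<noteq> 0" and "p \<in> lin_polys q"
  shows "\<exists>g\<in>lin_polys q. \<exists>r\<in>lin_polys q. degree r < degree f \<and> p = pcompose g f + r"
  using assms(3)
proof (induction "degree p" arbitrary: p rule: less_induct)
  case less
  show ?case
  proof (cases "degree p < degree f")
    case True
    then show ?thesis using less.prems lin_polys_0[of q]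
      by (intro bexI[of _ 0] bexI[of _ p]) auto
  next
    case False
    then have p: "p \<noteq> 0" using degree_lin_poly_pos[OF f] by auto
    define i where "i = q_degree q f"
    define j where "j = q_degree q p"
    have i: "degree f = q ^ i" and j: "degree p = q ^ j"
      using degree_lin_poly f p less.prems by (auto simp: i_def j_def)
    have "i \<le> j" using False q_gt_1 by (simp add: i j)
    \<comment> \<open>Composing raises the leading coefficient of \<open>f\<close> to the power
      \<open>q ^ (j - i)\<close>, which the denominator compensates.\<close>
    define a where "a = lead_coeff p / lead_coeff f ^ (q ^ (j - i))"
    define g where "g = monom a (q ^ (j - i))"
    define p' where "p' = p - pcompose g f"
    have g: "g \<in> lin_polys q" unfolding g_def by (rule lin_polys_monom)
    have gf: "pcompose g f = smult a (f ^ (q ^ (j - i)))"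
      by (simp add: g_def pcompose_monom)
    have a: "a \<noteq> 0" using p f by (simp add: a_def)
    have deg: "degree (pcompose g f) = degree p"
      using \<open>i \<le> j\<close> a f by (simp add: gf degree_power_eq i j flip: power_add)
    have "lead_coeff (pcompose g f) = lead_coeff p"
      unfolding gf using f by (simp add: lead_coeff_smult lead_coeff_power a_def)
    then have "coeff p' (degree p) = 0" by (simp add: p'_def deg)
    moreover have "degree p' \<le> degree p"
      unfolding p'_def by (rule degree_diff_le) (auto simp: deg)
    \<comment> \<open>Without this, a vanishing top coefficient could leave \<open>p' = 0\<close>
      with no drop in degree.\<close>
    moreover have "degree p > 0" using degree_lin_poly_pos less.prems p by blast
    ultimately have "degree p' < degree p"
      by (metis degree_0 le_neq_implies_less leading_coeff_0_iff)
    moreover have "p' \<in> lin_polys q"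
      unfolding p'_def using less.prems f g by (intro lin_polys_diff lin_polys_pcompose)
    ultimately obtain g' r where r: "g' \<in> lin_polys q" "r \<in> lin_polys q" "degree r < degree f"
      "p' = pcompose g' f + r"
      using less.hyps by blast
    have "p = pcompose (g + g') f + r"
      using r(4) by (simp add: p'_def pcompose_add algebra_simps)
    then show ?thesis using r g lin_polys_add by blast
  qed
qed

text \<open>Degrees multiply under composition, so \<open>g\<close> is constant, and a linearized
  polynomial has no constant term.\<close>

lemma pcompose_degree_less:
  fixes g f :: "'a poly"
  assumes "g \<in> lin_polys q" "degree (pcompose g f) < degree f"
  shows "g = 0"
proof -
  have "degree g = 0" using assms(2) by (simp add: degree_pcompose)
  then show ?thesis using degree_lin_poly_pos[OF assms(1)] by auto
qed

lemma right_rem: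
  fixes p f :: "'a poly"
  assumes f: "f \<in> lin_polys q" "f \<noteq> 0" and p: "p \<in> lin_polys q"
  shows right_rem_lin: "right_rem q p f \<in> lin_polys q"
    and degree_right_rem: "degree (right_rem q p f) < degree f"
    and right_rem_eq: "\<exists>g\<in>lin_polys q. p = pcompose g f + right_rem q p f"
proof -
  let ?P = "\<lambda>r. r \<in> lin_polys_lt q (q_degree q f) \<and> (\<exists>g\<in>lin_polys q. p = pcompose g f + r)"
  have "\<exists>!r. ?P r"
  proof (rule ex_ex1I)
    show "\<exists>r. ?P r"
      using right_division[OF f p] lin_polys_lt_q_degree_iff[OF f] by blast
  next
    fix r r' assume "?P r" "?P r'"
    then obtain g g' where g: "g \<in> lin_polys q" "g' \<in> lin_polys q"
      and eq: "p = pcompose g f + r" "p = pcompose g' f + r'"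
      and deg: "degree r < degree f" "degree r' < degree f"
      by (auto simp: lin_polys_lt_q_degree_iff[OF f])
    \<comment> \<open>Two remainders differ by a left multiple of \<open>f\<close> of smaller
      degree, which must be zero.\<close>
    have diff: "pcompose (g - g') f = r' - r"
      using eq by (simp add: pcompose_diff algebra_simps)
    then have "degree (pcompose (g - g') f) < degree f"
      using deg by (simp add: degree_diff_less)
    then have "g - g' = 0"
      using pcompose_degree_less g lin_polys_diff by blast
    then show "r = r'" using diff by simp
  qed
  then have "?P (right_rem q p f)"
    unfolding right_rem_def by (rule theI')
  then show "right_rem q p f \<in> lin_polys q" "degree (right_rem q p f) < degree f"
    "\<exists>g\<in>lin_polys q. p = pcompose g f + right_rem q p f"
    by (auto simp: lin_polys_lt_q_degree_iff[OF f])
qed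

section \<open>Left ideals\<close>

lemma left_ideal_self: "(f :: 'a poly) \<in> left_ideal q f"
  using lin_polys_X by (force simp: left_ideal_def pcompose_pCons)

lemma left_ideal_0: "0 \<in> left_ideal q (f :: 'a poly)"
  using lin_polys_0 by (force simp: left_ideal_def)

lemma left_ideal_of_0: "left_ideal q (0 :: 'a poly) = {0}"
proof -
  have "coeff p 0 = 0" if "p \<in> lin_polys q" for p :: "'a poly"
    using that q_gt_1 by (fastforce simp: lin_polys_iff)
  then have "left_ideal q (0 :: 'a poly) \<subseteq> {0}"
    by (auto simp: left_ideal_def pcompose_0')
  then show ?thesis using left_ideal_0 by blast
qed

lemma left_ideal_add:
  "g \<in> left_ideal q (f :: 'a poly) \<Longrightarrow> h \<in> left_ideal q f \<Longrightarrow> g + h \<in> left_ideal q f"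
  unfolding left_ideal_def using lin_polys_add by (fastforce simp flip: pcompose_add)

lemma left_ideal_diff:
  "g \<in> left_ideal q (f :: 'a poly) \<Longrightarrow> h \<in> left_ideal q f \<Longrightarrow> g - h \<in> left_ideal q f"
  unfolding left_ideal_def using lin_polys_diff by (fastforce simp flip: pcompose_diff)

lemma left_ideal_sum:
  "(\<And>i. i \<in> A \<Longrightarrow> g i \<in> left_ideal q (f :: 'a poly)) \<Longrightarrow> sum g A \<in> left_ideal q f"
  by (induction A rule: infinite_finite_induct) (auto intro: left_ideal_0 left_ideal_add)

lemma left_ideal_pcompose:
  "p \<in> lin_polys q \<Longrightarrow> g \<in> left_ideal q (f :: 'a poly) \<Longrightarrow> pcompose p g \<in> left_ideal q f"
  unfolding left_ideal_def using lin_polys_pcompose by (fastforce simp: pcompose_assoc)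

text \<open>As in a Euclidean ring, a nonzero element of least degree generates, since remainders by
  it stay in \<open>I\<close>.\<close>

lemma left_ideal_principal:
  assumes I: "I \<subseteq> lin_polys q" "(0 :: 'a poly) \<in> I"
    and diff: "\<And>g h. g \<in> I \<Longrightarrow> h \<in> I \<Longrightarrow> g - h \<in> I"
    and comp: "\<And>p g. p \<in> lin_polys q \<Longrightarrow> g \<in> I \<Longrightarrow> pcompose p g \<in> I"
  shows "\<exists>g\<in>lin_polys q. left_ideal q g = I"
proof (cases "I = {0}")
  case True
  then show ?thesis using left_ideal_of_0 lin_polys_0 by blast
next
  case False
  then obtain h where "h \<in> I \<and> h \<noteq> 0" using I by blast
  then obtain g where g: "g \<in> I" "g \<noteq> 0"
    and min: "\<And>h. h \<in> I \<Longrightarrow> h \<noteq> 0 \<Longrightarrow> degree g \<le> degree h"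
    using ex_has_least_nat[of "\<lambda>h. h \<in> I \<and> h \<noteq> 0" h degree] by blast
  have glin: "g \<in> lin_polys q" using g I by blast
  have "I \<subseteq> left_ideal q g"
  proof
    fix p assume p: "p \<in> I"
    obtain h r where h: "h \<in> lin_polys q" "degree r < degree g" "p = pcompose h g + r"
      using right_division[OF glin g(2), of p] p I by blast
    have "r = p - pcompose h g" using h by simp
    then have "r \<in> I" using diff[OF p comp[OF h(1) g(1)]] by simp
    then have "r = 0" using min h(2) by force
    then show "p \<in> left_ideal q g" using h by (auto simp: left_ideal_def)
  qed
  moreover have "left_ideal q g \<subseteq> I" using comp g by (auto simp: left_ideal_def)
  ultimately show ?thesis using glin by blast
qed

section \<open>Least left common multiples and Bezout coefficients\<close>

text \<open>An intersection of left ideals is again a left ideal, hence principal, so the choice in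
  \<open>lclm\<close> succeeds.\<close>

lemma is_lclm_lclm: "is_lclm q (A :: 'a poly set) (lclm q A)"
proof -
  have "\<exists>g\<in>lin_polys q. left_ideal q g = lin_polys q \<inter> (\<Inter>f\<in>A. left_ideal q f)"
    by (rule left_ideal_principal)
      (auto intro: lin_polys_0 left_ideal_0 lin_polys_diff left_ideal_diff
        lin_polys_pcompose left_ideal_pcompose)
  then have "\<exists>g. is_lclm q A g" by (auto simp: is_lclm_def)
  then show ?thesis unfolding lclm_def by (rule someI_ex)
qed

lemma lclm_mem_left_ideal: "f \<in> A \<Longrightarrow> lclm q A \<in> left_ideal q (f :: 'a poly)"
  using is_lclm_lclm[of A] left_ideal_self[of "lclm q A"] by (auto simp: is_lclm_def)

text \<open>
  A nonzero common left multiple comes from the pigeonhole principle: infinitely many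
  \<open>X ^ (q ^ i)\<close> share finitely many tuples of remainders, so some difference of two of them lies
  in all the left ideals.
\<close>

lemma lclm_nonzero:
  fixes A :: "'a poly set"
  assumes A: "finite A" "A \<subseteq> lin_polys q" "0 \<notin> A"
  shows "lclm q A \<noteq> 0"
proof -
  let ?h = "\<lambda>i. \<lambda>f\<in>A. right_rem q (monom 1 (q ^ i)) f"
  have "range ?h \<subseteq> (\<Pi>\<^sub>E f\<in>A. {r. degree r < degree f})"
    using A by (auto intro!: degree_right_rem lin_polys_monom)
  then have "finite (range ?h)"
    using A(1) finite_degree_less by (rule finite_subset[OF _ finite_PiE])
  then have "\<not> inj ?h" using finite_imageD infinite_UNIV_nat by blast
  then obtain i j where ij: "i \<noteq> j" "?h i = ?h j" by (auto simp: inj_def)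
  let ?p = "monom 1 (q ^ i) - monom 1 (q ^ j) :: 'a poly"
  have "?p \<in> left_ideal q f" if f: "f \<in> A" for f
  proof -
    have rem: "right_rem q (monom 1 (q ^ i)) f = right_rem q (monom 1 (q ^ j)) f"
      using fun_cong[OF ij(2), of f] f by simp
    have "monom 1 (q ^ k) - right_rem q (monom 1 (q ^ k)) f \<in> left_ideal q f" for k
    proof -
      have "f \<in> lin_polys q" "f \<noteq> 0" using f A by auto
      from right_rem_eq[OF this lin_polys_monom] obtain g
        where "g \<in> lin_polys q" "monom 1 (q ^ k) = pcompose g f + right_rem q (monom 1 (q ^ k)) f"
        by blast
      then have "g \<in> lin_polys q" "monom 1 (q ^ k) - right_rem q (monom 1 (q ^ k)) f = pcompose g f"
        by (simp_all only: diff_eq_eq)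
      then show ?thesis unfolding left_ideal_def by blast
    qed
    from left_ideal_diff[OF this[of i] this[of j]] show ?thesis by (simp add: rem)
  qed
  moreover have "?p \<in> lin_polys q" by (intro lin_polys_diff lin_polys_monom)
  ultimately have "?p \<in> left_ideal q (lclm q A)"
    using is_lclm_lclm[of A] by (auto simp: is_lclm_def)
  moreover have "coeff ?p (q ^ i) \<noteq> 0" using ij q_gt_1 by simp
  then have "?p \<noteq> 0" by (metis coeff_0)
  ultimately show ?thesis using left_ideal_of_0 by auto
qed

text \<open>The left ideal generated by \<open>b\<close> and \<open>f\<close> has a single generator
  \<open>g\<close>. As \<open>g\<close> divides both on the right, it divides their greatest common
  right divisor, a nonzero multiple of \<open>X\<close>.\<close>

lemma right_coprime_bezout:
  fixes f b :: "'a poly"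
  assumes f: "f \<in> lin_polys q" and b: "b \<in> lin_polys q" and cop: "right_coprime q f b"
  shows "\<exists>S1\<in>lin_polys q. \<exists>S2\<in>lin_polys q. pcompose S1 b + pcompose S2 f = [:0, 1:]"
proof -
  let ?I = "{pcompose S1 b + pcompose S2 f |S1 S2. S1 \<in> lin_polys q \<and> S2 \<in> lin_polys q}"
  have "\<exists>g\<in>lin_polys q. left_ideal q g = ?I"
  proof (rule left_ideal_principal)
    show "?I \<subseteq> lin_polys q" using f b by (auto intro: lin_polys_add lin_polys_pcompose)
    show "0 \<in> ?I" using lin_polys_0[of q] by force
  next
    fix g h assume "g \<in> ?I" "h \<in> ?I"
    then obtain S1 S2 T1 T2 where S: "S1 \<in> lin_polys q" "S2 \<in> lin_polys q"
        "T1 \<in> lin_polys q" "T2 \<in> lin_polys q"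
      and "g = pcompose S1 b + pcompose S2 f" "h = pcompose T1 b + pcompose T2 f" by blast
    then have "g - h = pcompose (S1 - T1) b + pcompose (S2 - T2) f"
      by (simp add: pcompose_diff)
    then show "g - h \<in> ?I" using S lin_polys_diff by blast
  next
    fix p g :: "'a poly" assume p: "p \<in> lin_polys q" and "g \<in> ?I"
    then obtain S1 S2 where S: "S1 \<in> lin_polys q" "S2 \<in> lin_polys q"
      and "g = pcompose S1 b + pcompose S2 f" by blast
    then have "pcompose p g = pcompose (pcompose p S1) b + pcompose (pcompose p S2) f"
      using p by (simp add: pcompose_lin_add pcompose_assoc)
    then show "pcompose p g \<in> ?I" using p S lin_polys_pcompose by blast
  qed
  then obtain g where g: "g \<in> lin_polys q" "left_ideal q g = ?I" by blast
  have "b = pcompose [:0, 1:] b + pcompose 0 f" "f = pcompose 0 b + pcompose [:0, 1:] f"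
    by (simp_all add: pcompose_pCons)
  then have "b \<in> left_ideal q g" "f \<in> left_ideal q g"
    unfolding g(2) using lin_polys_0 lin_polys_X by blast+
  then obtain c where c: "c \<noteq> 0" "smult c [:0, 1:] \<in> left_ideal q g"
    using cop g(1) unfolding right_coprime_def is_gcrd_def by blast
  \<comment> \<open>Composing with the inverse scalar normalizes this multiple to
    \<open>X\<close>.\<close>
  then have "pcompose (smult (inverse c) [:0, 1:]) (smult c [:0, 1:]) \<in> left_ideal q g"
    by (intro left_ideal_pcompose lin_polys_smult lin_polys_X)
  moreover have "pcompose (smult (inverse c) [:0, 1:]) (smult c [:0, 1:]) = [:0, 1:]"
    using c by (simp add: pcompose_pCons)
  ultimately have "[:0, 1:] \<in> ?I" unfolding g(2) by simp
  then show ?thesis by (smt (verit) mem_Collect_eq)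
qed

section \<open>Chinese Remainder lifting\<close>

text \<open>\<open>S i\<close> composed with \<open>b i\<close> is congruent to \<open>X\<close>
  modulo \<open>f i\<close> and to 0 modulo the other \<open>f j\<close>, so the sum has the
  prescribed residues; reducing modulo the common multiple \<open>L\<close> preserves them.\<close>

lemma crt_lift:
  fixes f e :: "nat \<Rightarrow> 'a poly"
  assumes f: "\<And>i. i \<in> {1..s} \<Longrightarrow> f i \<in> lin_polys q \<and> f i \<noteq> 0"
    and cop: "\<And>i. i \<in> {1..s} \<Longrightarrow> right_coprime q (f i) (cofactor_lclm q s f i)"
    and e: "\<And>i. i \<in> {1..s} \<Longrightarrow> e i \<in> lin_polys q"
  shows crt_lift_lin: "crt_lift q s f e \<in> lin_polys q"
    and degree_crt_lift: "degree (crt_lift q s f e) < degree (lclm q (f ` {1..s}))"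
    and crt_lift_cong: "\<And>j. j \<in> {1..s} \<Longrightarrow> crt_lift q s f e - e j \<in> left_ideal q (f j)"
proof -
  define b where "b = cofactor_lclm q s f"
  define S where "S = (\<lambda>i. bezout_left q (b i) (f i))"
  define L where "L = lclm q (f ` {1..s})"
  define t where "t = (\<lambda>i. pcompose (e i) (pcompose (S i) (b i)))"
  have lift: "crt_lift q s f e = right_rem q (sum t {1..s}) L"
    unfolding crt_lift_def t_def S_def b_def L_def ..
  have L: "L \<in> lin_polys q"
    using is_lclm_lclm[of "f ` {1..s}"] by (simp add: L_def is_lclm_def)
  have "f ` {1..s} \<subseteq> lin_polys q"
    using f by (intro image_subsetI) simp
  moreover have "0 \<notin> f ` {1..s}"
    using f by (metis imageE)
  ultimately have "L \<noteq> 0" unfolding L_def by (intro lclm_nonzero) simp_all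
  note L = L this
  have b: "b i \<in> lin_polys q" for i
    using is_lclm_lclm by (auto simp: b_def cofactor_lclm_def is_lclm_def)
  have S: "S i \<in> lin_polys q \<and>
      (\<exists>S2\<in>lin_polys q. pcompose (S i) (b i) + pcompose S2 (f i) = [:0, 1:])"
    if "i \<in> {1..s}" for i
    unfolding S_def bezout_left_def
    by (rule someI_ex) (use right_coprime_bezout[of "f i" "b i"] f cop b that in \<open>auto simp: b_def\<close>)
  have t: "t i \<in> lin_polys q" if "i \<in> {1..s}" for i
    unfolding t_def using e S b that by (intro lin_polys_pcompose) auto
  have T: "sum t {1..s} \<in> lin_polys q"
    using t by (rule lin_polys_sum)
  show "crt_lift q s f e \<in> lin_polys q" "degree (crt_lift q s f e) < degree (lclm q (f ` {1..s}))"
    using right_rem_lin[OF L T] degree_right_rem[OF L T] by (simp_all add: lift L_def)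
  fix j assume j: "j \<in> {1..s}"
  have other: "t i \<in> left_ideal q (f j)" if i: "i \<in> {1..s} - {j}" for i
  proof -
    have "b i \<in> left_ideal q (f j)"
      unfolding b_def cofactor_lclm_def using i j by (intro lclm_mem_left_ideal) auto
    then show ?thesis
      unfolding t_def using e S i by (intro left_ideal_pcompose) auto
  qed
  obtain S2 where S2: "S2 \<in> lin_polys q" "pcompose (S j) (b j) + pcompose S2 (f j) = [:0, 1:]"
    using S[OF j] by blast
  then have "pcompose (S j) (b j) = [:0, 1:] - pcompose S2 (f j)"
    by (simp add: eq_diff_eq)
  \<comment> \<open>Uses additivity of the linearized \<open>e j\<close> in its inner
    argument.\<close>
  then have "t j - e j = 0 - pcompose (e j) (pcompose S2 (f j))"
    unfolding t_def using e[OF j] by (simp add: pcompose_lin_diff)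
  also have "\<dots> \<in> left_ideal q (f j)"
    using e[OF j] S2(1) by (intro left_ideal_diff left_ideal_0 left_ideal_pcompose left_ideal_self)
  finally have "t j - e j \<in> left_ideal q (f j)" .
  then have "(t j - e j) + sum t ({1..s} - {j}) \<in> left_ideal q (f j)"
    using other by (intro left_ideal_add left_ideal_sum)
  then have 1: "sum t {1..s} - e j \<in> left_ideal q (f j)"
    using j by (simp add: sum.remove algebra_simps)
  obtain g where g: "g \<in> lin_polys q" "sum t {1..s} = pcompose g L + crt_lift q s f e"
    using right_rem_eq[OF L T] lift by auto
  have "L \<in> left_ideal q (f j)" unfolding L_def using j by (intro lclm_mem_left_ideal) auto
  then have "(sum t {1..s} - e j) - pcompose g L \<in> left_ideal q (f j)"
    by (intro left_ideal_diff[OF 1] left_ideal_pcompose[OF g(1)])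
  then show "crt_lift q s f e - e j \<in> left_ideal q (f j)"
    using g(2) by (simp add: algebra_simps)
qed

end

section \<open>Support of the lifting\<close>

lemma coeff_mem:
  assumes "set (coeffs p) \<subseteq> V" "0 \<in> V"
  shows "coeff p k \<in> V"
proof -
  have "coeff p k \<in> insert 0 (set (coeffs p))"
    unfolding range_coeff[symmetric] by (rule rangeI)
  then show ?thesis using assms by auto
qed

lemma coeff_power_subfield:
  assumes "is_subfield K" "\<And>k. coeff f k \<in> K"
  shows "coeff (f ^ n) k \<in> K"
proof (induction n arbitrary: k)
  case 0
  then show ?case using assms(1) by (auto simp: is_subfield_def coeff_1)
next
  case (Suc n)
  show ?case
    unfolding power_Suc
    by (rule coeff_mult_semiring_closed)
      (use assms Suc in \<open>auto simp: is_subfield_def\<close>)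
qed

lemma additive_zero:
  fixes \<phi> :: "'a::monoid_add \<Rightarrow> 'b::group_add"
  assumes "\<And>x y. \<phi> (x + y) = \<phi> x + \<phi> y"
  shows "\<phi> 0 = 0"
proof -
  have "\<phi> 0 + 0 = \<phi> 0 + \<phi> 0" by (simp flip: assms)
  then show ?thesis by (metis add_left_cancel)
qed

text \<open>Coefficients of the composition are sums of \<open>coeff g k * coeff (f ^ k) n\<close>.
  The second factor lies in \<open>K\<close>, so it moves out of \<open>\<phi>\<close>.\<close>

lemma map_poly_pcompose_subfield:
  fixes \<phi> :: "'a::field \<Rightarrow> 'a"
  assumes K: "is_subfield K" and f: "\<And>k. coeff f k \<in> K"
    and add: "\<And>x y. \<phi> (x + y) = \<phi> x + \<phi> y"
    and scale: "\<And>c x. c \<in> K \<Longrightarrow> \<phi> (c * x) = c * \<phi> x"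
  shows "map_poly \<phi> (pcompose g f) = pcompose (map_poly \<phi> g) f"
proof (rule poly_eqI)
  fix n
  have \<phi>0: "\<phi> 0 = 0" by (rule additive_zero) (rule add)
  have sum: "\<phi> (sum h A) = (\<Sum>x\<in>A. \<phi> (h x))" for h :: "nat \<Rightarrow> 'a" and A
    by (induction A rule: infinite_finite_induct) (simp_all add: \<phi>0 add)
  have deg: "degree (map_poly \<phi> g) \<le> degree g"
    by (intro degree_le) (simp add: coeff_map_poly \<phi>0 coeff_eq_0)
  have "\<phi> (coeff g k * coeff (f ^ k) n) = \<phi> (coeff g k) * coeff (f ^ k) n" for k
    using scale[OF coeff_power_subfield[OF K f, of k n]] by (simp add: mult.commute)
  then show "coeff (map_poly \<phi> (pcompose g f)) n = coeff (pcompose (map_poly \<phi> g) f) n"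
    by (simp add: coeff_map_poly \<phi>0 pcompose_eq_sum[OF deg] pcompose_eq_sum[OF order_refl, of g]
        coeff_sum sum)
qed

lemma (in frobenius_power) coeffs_crt_lift:
  fixes f e :: "nat \<Rightarrow> 'a poly"
  assumes K: "is_subfield K" and V: "subspace_over K V"
    and f: "\<And>i. i \<in> {1..s} \<Longrightarrow> f i \<in> lin_polys_over q K \<and> f i \<noteq> 0"
    and cop: "\<And>i. i \<in> {1..s} \<Longrightarrow> right_coprime q (f i) (cofactor_lclm q s f i)"
    and e: "\<And>i. i \<in> {1..s} \<Longrightarrow> e i \<in> lin_polys q \<and> set (coeffs (e i)) \<subseteq> V"
  shows "coeff (crt_lift q s f e) k \<in> V"
proof -
  let ?E = "crt_lift q s f e"
  let ?L = "lclm q (f ` {1..s})"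
  obtain \<phi> :: "'a \<Rightarrow> 'a" where add: "\<And>x y. \<phi> (x + y) = \<phi> x + \<phi> y"
    and scale: "\<And>c x. c \<in> K \<Longrightarrow> \<phi> (c * x) = c * \<phi> x"
    and ker: "\<And>x. \<phi> x = 0 \<longleftrightarrow> x \<in> V"
    using linear_map_with_kernel[OF K finite finite V] by metis
  have \<phi>0: "\<phi> 0 = 0" by (rule additive_zero) (rule add)
  note coeff_\<phi> = coeff_map_poly[of \<phi>, OF \<phi>0]
  \<comment> \<open>Since \<open>\<phi> 0 = 0\<close>, no new monomials appear.\<close>
  have map_lin: "map_poly \<phi> p \<in> lin_polys q" if "p \<in> lin_polys q" for p
    using that \<phi>0 by (metis lin_polys_iff coeff_\<phi>)
  have flin: "f i \<in> lin_polys q \<and> f i \<noteq> 0" if "i \<in> {1..s}" for i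
    using f[OF that] by (auto simp: lin_polys_over_def)
  have fK: "coeff (f i) k \<in> K" if "i \<in> {1..s}" for i k
    using f[OF that] K by (intro coeff_mem) (auto simp: lin_polys_over_def is_subfield_def)
  have elin: "e i \<in> lin_polys q" if "i \<in> {1..s}" for i using e[OF that] by simp
  have map_e: "map_poly \<phi> (e i) = 0" if "i \<in> {1..s}" for i
  proof (rule poly_eqI)
    fix k
    have "coeff (e i) k \<in> V"
      using e[OF that] V by (intro coeff_mem) (auto simp: subspace_over_def)
    then show "coeff (map_poly \<phi> (e i)) k = coeff 0 k" by (simp add: coeff_\<phi> ker)
  qed
  have "map_poly \<phi> ?E \<in> left_ideal q (f j)" if j: "j \<in> {1..s}" for j
  proof -
    obtain g where g: "g \<in> lin_polys q" "?E - e j = pcompose g (f j)"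
      using crt_lift_cong[of s f e j, OF flin cop elin j] by (auto simp: left_ideal_def)
    then have "?E = pcompose g (f j) + e j" by (simp add: algebra_simps)
    then have "map_poly \<phi> ?E = map_poly \<phi> (pcompose g (f j)) + map_poly \<phi> (e j)"
      by (intro poly_eqI) (simp add: coeff_\<phi> add)
    also have "\<dots> = pcompose (map_poly \<phi> g) (f j)"
      by (simp add: map_e[OF j] map_poly_pcompose_subfield[OF K fK[OF j] add scale])
    finally show ?thesis using map_lin[OF g(1)] by (auto simp: left_ideal_def)
  qed
  moreover have "map_poly \<phi> ?E \<in> lin_polys q"
    using crt_lift_lin[of s f e, OF flin cop elin] by (rule map_lin)
  ultimately have "map_poly \<phi> ?E \<in> left_ideal q ?L"
    using is_lclm_lclm[of "f ` {1..s}"] by (auto simp: is_lclm_def)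
  then obtain g where g: "g \<in> lin_polys q" "map_poly \<phi> ?E = pcompose g ?L"
    by (auto simp: left_ideal_def)
  \<comment> \<open>Applying \<open>\<phi>\<close> cannot raise the degree, so the image stays below
    the degree of \<open>?L\<close> while being a left multiple of it.\<close>
  have "degree (map_poly \<phi> ?E) \<le> degree ?E"
    by (intro degree_le) (simp add: coeff_\<phi> \<phi>0 coeff_eq_0)
  then have "degree (map_poly \<phi> ?E) < degree ?L"
    using degree_crt_lift[of s f e, OF flin cop elin]
    by (rule le_less_trans)
  then have "g = 0"
    unfolding g(2) by (rule pcompose_degree_less[OF g(1)])
  then have "map_poly \<phi> ?E = 0" using g(2) by simp
  then have "\<phi> (coeff ?E k) = 0" by (metis coeff_\<phi> coeff_0)
  then show ?thesis by (simp add: ker)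
qed

section \<open>Inclusion of supports and dimension bound\<close>

theorem proposition25:
  fixes q m l s n r :: nat
    and F K :: "'a::{field, finite} set"
    and d :: "nat \<Rightarrow> nat"
    and f e :: "nat \<Rightarrow> 'a poly"
    and E :: "'a poly"
  assumes "primepow q" and "m \<ge> 1"
    and "CARD('a) = q ^ m"
    and "is_subfield F" and "card F = q"
    and "is_subfield K" and "card K = q ^ l"
    and "\<And>i. i \<in> {1..s} \<Longrightarrow> f i \<in> lin_polys_over q K \<and> f i \<noteq> 0 \<and> q_degree q (f i) = d i"
    and "n = (\<Sum>i=1..s. d i)"
    and "\<And>i. i \<in> {1..s} \<Longrightarrow> right_coprime q (f i) (cofactor_lclm q s f i)"
    and "\<And>i. i \<in> {1..s} \<Longrightarrow> e i \<in> lin_polys_lt q (d i)"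
    and "rank_weight F s e \<le> r"
    and "E = crt_lift q s f e"
  shows "supp F E \<subseteq> span_prod F (supp_tuple F s e) K \<and> dim_over F (supp F E) \<le> r * l"
proof -
  \<comment> \<open>The characteristic is a prime dividing the field size, a power of
    \<open>p\<close>, so it equals \<open>p\<close>.\<close>
  interpret frobenius_power q "TYPE('a)"
  proof
    obtain p k where p: "prime p" "k > 0" "q = p ^ k"
      using \<open>primepow q\<close> by (auto simp: primepow_def)
    have "CHAR('a) dvd p ^ (k * m)"
      using CHAR_dvd_CARD_finite[where 'a = 'a] \<open>CARD('a) = q ^ m\<close> p by (simp add: power_mult)
    then have "CHAR('a) = p"
      using prime_CHAR_finite_field[where 'a = 'a] p(1)
      by (meson prime_dvd_power primes_dvd_imp_eq)
    then show "\<exists>k>0. q = CHAR('a) ^ k" using p by blast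
  qed
  let ?A = "supp_tuple F s e"
  let ?V = "span_prod F ?A K"
  have "F \<subseteq> K"
    using assms(4-7) by (intro subfield_mono[of _ _ l]) auto
  have subA: "subspace_over F ?A" unfolding supp_tuple_def by (rule subspace_over_span)
  have subV: "subspace_over K ?V" using assms(6) by (rule subspace_over_span_prod)
  have subVF: "subspace_over F ?V" unfolding span_prod_def by (rule subspace_over_span)
  have "a \<in> ?V" if "a \<in> ?A" for a
  proof -
    \<comment> \<open>As 1 lies in \<open>K\<close>, the support of \<open>e\<close> is contained in
      \<open>?V\<close>.\<close>
    have "a * 1 \<in> {a * b |a b. a \<in> ?A \<and> b \<in> K}"
      using that assms(6) unfolding is_subfield_def by blast
    then show ?thesis unfolding span_prod_def using span_over_superset by force
  qed
  moreover have "set (coeffs (e i)) \<subseteq> ?A" if "i \<in> {1..s}" for i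
    unfolding supp_tuple_def using that
    by (intro order.trans[OF _ span_over_superset]) blast
  ultimately have e: "e i \<in> lin_polys q \<and> set (coeffs (e i)) \<subseteq> ?V" if "i \<in> {1..s}" for i
    using assms(11)[OF that] that by (auto simp: lin_polys_lt_def)
  have "coeff E k \<in> ?V" for k
    unfolding assms(13) using assms(8,10) e by (intro coeffs_crt_lift[OF assms(6) subV]) auto
  then have "set (coeffs E) \<subseteq> ?V" by (auto simp: coeffs_def)
  then have sub: "supp F E \<subseteq> ?V"
    unfolding supp_def by (intro span_over_minimal subVF)
  have subE: "subspace_over F (supp F E)" unfolding supp_def by (rule subspace_over_span)
  \<comment> \<open>The dimension bound is read off from cardinalities: \<open>?V\<close> has at
    most \<open>(q ^ l) ^ r\<close> elements, and exponents of \<open>q > 1\<close> can be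
    compared.\<close>
  have "q ^ dim_over F (supp F E) = card (supp F E)"
    using card_subspace_over[OF assms(4) subE] assms(5) by simp
  also have "\<dots> \<le> card ?V" using sub by (intro card_mono) auto
  also have "\<dots> \<le> card K ^ dim_over F ?A"
    using card_span_prod_le[OF assms(4) assms(6) _ \<open>F \<subseteq> K\<close> subA] by simp
  also have "\<dots> \<le> q ^ (r * l)"
    using assms(7,12) q_gt_1
    by (simp add: rank_weight_def mult.commute[of r] flip: power_mult)
  finally have "dim_over F (supp F E) \<le> r * l" using q_gt_1 by simp
  with sub show ?thesis ..
qed

end
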